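(* Consider the kinetic scheme (KS) defined in the context, and assume that at each step $u_i^n>0$ for all $i$ and the CFL condition $$(\|h\|_\infty+2\|a\|_\infty)\,\Delta x^n\le\min_i(u_i^n)\,\Delta t$$ holds (norms on $[0,1]$). Then for every real smooth function $\psi$ with $\psi''\ge0$, the discrete unknowns $(u_i^n,c_i^n)$ satisfy, for all $n\ge0$, $i\ge1$, the discrete entropy inequality $$u_i^n\,\psi(c_i^{n+1})\le u_i^n\,\psi(c_i^n)-\frac{\Delta x^n}{\Delta t}\big(\Phi_{i+1/2}^n-\Phi_{i-1/2}^n\big)-\frac{\Delta x^n}{\Delta t}\,h(c_i^n)\big(\psi(c_i^n)-\psi(c_{i-1}^n)\big),$$ where $\Phi_{i+1/2}^n=\Phi^+(c_i^n)-\Phi^-(c_{i+1}^n)$ and $\Phi^\pm(c)=\int_0^c\psi'(\xi)\,a^\pm(\xi)\,d\xi$.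
   Context: Isotherms: $q_1,q_2:[0,1]\to\mathbb{R}$ are continuously differentiable, $q_1'\ge0\ge q_2'$, $h=q_1+q_2\ge0$, $f(c)=q_1(c)-c\,h(c)$, $a(\xi)=1+f'(\xi)$ on $[0,1]$. Put $a^+=\max(a,0)$, $a^-=-\min(a,0)$, $A^\pm(c)=\int_0^c a^\pm(\xi)\,d\xi$, and $\chi(c,\xi)=1$ if $0<\xi<c$, $0$ otherwise. Data: $c_b,c_0:(0,\infty)\to[0,1]$ and $u_b:(0,\infty)\to(0,\infty)$ bounded, measurable, $\inf u_b>0$. The scheme approximates the system $\partial_x(uc)+\partial_t(c+q_1(c))=0$, $\partial_xu+\partial_th(c)=0$ with $c(t,0)=c_b(t)$, $u(t,0)=u_b(t)$, $c(0,x)=c_0(x)$; $x$ is the evolution variable. Mesh: $\Delta t>0$; temporal cells $Te_i=(t_{i-1/2},t_{i+1/2})$ of length $\Delta t$, $i\ge1$, $t_{1/2}=0$; $x_0=0$, $x_{n+1}=x_n+\Delta x^n$ with $\Delta x^n>0$. Scheme (KS): initial and boundary values $$c_0^n=\frac1{\Delta x^n}\int_{x_n}^{x_{n+1}}c_0(x)\,dx\ (n\ge0),\qquad u_i^0=\frac1{\Delta t}\int_{Te_i}u_b\,dt,\quad c_i^0=\frac1{\Delta t}\int_{Te_i}c_b\,dt\ (i\ge1).$$ Given $(u_i^n,c_i^n)_{i\ge1}$, set $\chi_i^n(\xi)=\chi(c_i^n,\xi)$ ($i\ge0$), $\lambda_i^n=\frac{\Delta x^n}{u_i^n\Delta t}$,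 and for $i\ge1$, $\xi\in(0,1)$ define $\phi_i^{n+1}(\xi)$ by $$\Delta t\,u_i^n\big(\phi_i^{n+1}(\xi)-\chi_i^n(\xi)\big)+a(\xi)\Delta x^n\big(\phi_{i+1/2}^n(\xi)-\phi_{i-1/2}^n(\xi)\big)+\Delta x^n h(c_i^n)\big(\chi_i^n(\xi)-\chi_{i-1}^n(\xi)\big)=0,$$ where $a(\xi)\phi_{i+1/2}^n(\xi)=a^+(\xi)\chi_i^n(\xi)-a^-(\xi)\chi_{i+1}^n(\xi)$. Then $c_i^{n+1}=\int_0^1\phi_i^{n+1}(\xi)\,d\xi$, i.e. $$c_i^{n+1}=c_i^n-\lambda_i^n\Big\{(A^+(c_i^n)-A^+(c_{i-1}^n))-(A^-(c_{i+1}^n)-A^-(c_i^n))+h(c_i^n)(c_i^n-c_{i-1}^n)\Big\},$$ and $$u_i^{n+1}=u_i^n-\frac{\Delta x^n}{\Delta t}\big(h(c_{i+1}^n)-h(c_{i-1}^n)\big)\qquad(i\ge1).$$ The index $i$ ranges over all integers $\ge1$, and $\min_i$ is understood as $\inf_i$. *)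

theory Defs
  imports "HOL-Analysis.Analysis"
begin

subsection \<open>Functions on the unit interval\<close>

text \<open>The derivative is one-sided at 0 and 1; values of the function outside [0,1] are irrelevant
  to it.\<close>

definition deriv01 :: "(real \<Rightarrow> real) \<Rightarrow> real \<Rightarrow> real" where
  "deriv01 g x = vector_derivative g (at x within {0..1})"

definition C1_01 :: "(real \<Rightarrow> real) \<Rightarrow> bool" where
  "C1_01 g \<longleftrightarrow>
     (\<forall>x\<in>{0..1}. g differentiable (at x within {0..1})) \<and> continuous_on {0..1} (deriv01 g)"

definition supnorm01 :: "(real \<Rightarrow> real) \<Rightarrow> real" where
  "supnorm01 g = (SUP x\<in>{0..1}. \<bar>g x\<bar>)"

definition smooth_real :: "(real \<Rightarrow> real) \<Rightarrow> bool" where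
  "smooth_real \<psi> \<longleftrightarrow> (\<forall>k x. (deriv ^^ k) \<psi> field_differentiable (at x))"


subsection \<open>Isotherms\<close>

definition iso_h :: "(real \<Rightarrow> real) \<Rightarrow> (real \<Rightarrow> real) \<Rightarrow> real \<Rightarrow> real" where
  "iso_h q1 q2 c = q1 c + q2 c"

definition iso_f :: "(real \<Rightarrow> real) \<Rightarrow> (real \<Rightarrow> real) \<Rightarrow> real \<Rightarrow> real" where
  "iso_f q1 q2 c = q1 c - c * iso_h q1 q2 c"

definition iso_a :: "(real \<Rightarrow> real) \<Rightarrow> (real \<Rightarrow> real) \<Rightarrow> real \<Rightarrow> real" where
  "iso_a q1 q2 \<xi> = 1 + deriv01 (iso_f q1 q2) \<xi>"

definition iso_a_pos :: "(real \<Rightarrow> real) \<Rightarrow> (real \<Rightarrow> real) \<Rightarrow> real \<Rightarrow> real" where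
  "iso_a_pos q1 q2 \<xi> = max (iso_a q1 q2 \<xi>) 0"

definition iso_a_neg :: "(real \<Rightarrow> real) \<Rightarrow> (real \<Rightarrow> real) \<Rightarrow> real \<Rightarrow> real" where
  "iso_a_neg q1 q2 \<xi> = - min (iso_a q1 q2 \<xi>) 0"

definition isotherms :: "(real \<Rightarrow> real) \<Rightarrow> (real \<Rightarrow> real) \<Rightarrow> bool" where
  "isotherms q1 q2 \<longleftrightarrow>
     C1_01 q1 \<and> C1_01 q2 \<and>
     (\<forall>x\<in>{0..1}. deriv01 q1 x \<ge> 0) \<and> (\<forall>x\<in>{0..1}. deriv01 q2 x \<le> 0) \<and>
     (\<forall>x\<in>{0..1}. iso_h q1 q2 x \<ge> 0)"


subsection \<open>Data and mesh\<close>

definition admissible_data ::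
    "(real \<Rightarrow> real) \<Rightarrow> (real \<Rightarrow> real) \<Rightarrow> (real \<Rightarrow> real) \<Rightarrow> bool" where
  "admissible_data cb c0 ub \<longleftrightarrow>
     cb \<in> borel_measurable (lebesgue_on {0<..}) \<and> (\<forall>t>0. cb t \<in> {0..1}) \<and>
     c0 \<in> borel_measurable (lebesgue_on {0<..}) \<and> (\<forall>x>0. c0 x \<in> {0..1}) \<and>
     ub \<in> borel_measurable (lebesgue_on {0<..}) \<and> (\<forall>t>0. ub t > 0) \<and>
     bounded (ub ` {0<..}) \<and> (INF t\<in>{0<..}. ub t) > 0"

text \<open>The cell with centre (i - 1/2) dt, meaningful for i at least 1.\<close>

definition time_cell :: "real \<Rightarrow> nat \<Rightarrow> real set" where
  "time_cell dt i = {(real i - 1) * dt <..< real i * dt}"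

definition space_node :: "(nat \<Rightarrow> real) \<Rightarrow> nat \<Rightarrow> real" where
  "space_node dx n = (\<Sum>k<n. dx k)"


subsection \<open>The kinetic scheme\<close>

definition kchi :: "real \<Rightarrow> real \<Rightarrow> real" where
  "kchi c \<xi> = (if 0 < \<xi> \<and> \<xi> < c then 1 else 0)"

text \<open>The interface flux \<open>a(\<xi>) \<phi>\<^sub>i\<^sub>+\<^sub>1\<^sub>/\<^sub>2(\<xi>)\<close> between a left state \<open>cl\<close> (cell \<open>i\<close>) and a right state
  \<open>cr\<close> (cell \<open>i + 1\<close>). Only this product is determined by the scheme, not the interface value
  itself, which is arbitrary where \<open>a\<close> vanishes.\<close>

definition kflux ::
    "(real \<Rightarrow> real) \<Rightarrow> (real \<Rightarrow> real) \<Rightarrow> real \<Rightarrow> real \<Rightarrow> real \<Rightarrow> real" where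
  "kflux q1 q2 cl cr \<xi> = iso_a_pos q1 q2 \<xi> * kchi cl \<xi> - iso_a_neg q1 q2 \<xi> * kchi cr \<xi>"

text \<open>The first argument of \<open>u\<close>, \<open>c\<close> and \<open>\<phi>\<close> is the evolution index \<open>n\<close> (in \<open>x\<close>), the second argument
  the cell index \<open>i\<close> (in \<open>t\<close>). The column \<open>c n 0\<close> carries the boundary values; \<open>u n 0\<close>,
  \<open>\<phi> n 0\<close> and \<open>\<phi> 0 i\<close> are unused.\<close>

definition kinetic_scheme ::
    "(real \<Rightarrow> real) \<Rightarrow> (real \<Rightarrow> real) \<Rightarrow> (real \<Rightarrow> real) \<Rightarrow> (real \<Rightarrow> real) \<Rightarrow> (real \<Rightarrow> real) \<Rightarrow>
     real \<Rightarrow> (nat \<Rightarrow> real) \<Rightarrow>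
     (nat \<Rightarrow> nat \<Rightarrow> real) \<Rightarrow> (nat \<Rightarrow> nat \<Rightarrow> real) \<Rightarrow> (nat \<Rightarrow> nat \<Rightarrow> real \<Rightarrow> real) \<Rightarrow> bool" where
  "kinetic_scheme q1 q2 cb c0 ub dt dx u c \<phi> \<longleftrightarrow>
     (\<forall>n. c n 0 = (LINT x:{space_node dx n <..< space_node dx (Suc n)}|lebesgue. c0 x) / dx n) \<and>
     (\<forall>i\<ge>1. u 0 i = (LINT t:time_cell dt i|lebesgue. ub t) / dt) \<and>
     (\<forall>i\<ge>1. c 0 i = (LINT t:time_cell dt i|lebesgue. cb t) / dt) \<and>
     (\<forall>n. \<forall>i\<ge>1. \<forall>\<xi>\<in>{0<..<1}.
        dt * u n i * (\<phi> (Suc n) i \<xi> - kchi (c n i) \<xi>)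
        + dx n * (kflux q1 q2 (c n i) (c n (i + 1)) \<xi> - kflux q1 q2 (c n (i - 1)) (c n i) \<xi>)
        + dx n * iso_h q1 q2 (c n i) * (kchi (c n i) \<xi> - kchi (c n (i - 1)) \<xi>) = 0) \<and>
     (\<forall>n. \<forall>i\<ge>1. c (Suc n) i = (LINT \<xi>:{0<..<1}|lebesgue. \<phi> (Suc n) i \<xi>)) \<and>
     (\<forall>n. \<forall>i\<ge>1. u (Suc n) i =
        u n i - dx n / dt * (iso_h q1 q2 (c n (i + 1)) - iso_h q1 q2 (c n (i - 1))))"


subsection \<open>Discrete entropy flux\<close>

definition Phi_pos :: "(real \<Rightarrow> real) \<Rightarrow> (real \<Rightarrow> real) \<Rightarrow> (real \<Rightarrow> real) \<Rightarrow> real \<Rightarrow> real" where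
  "Phi_pos q1 q2 \<psi> c = (LINT \<xi>:{0..c}|lebesgue. deriv \<psi> \<xi> * iso_a_pos q1 q2 \<xi>)"

definition Phi_neg :: "(real \<Rightarrow> real) \<Rightarrow> (real \<Rightarrow> real) \<Rightarrow> (real \<Rightarrow> real) \<Rightarrow> real \<Rightarrow> real" where
  "Phi_neg q1 q2 \<psi> c = (LINT \<xi>:{0..c}|lebesgue. deriv \<psi> \<xi> * iso_a_neg q1 q2 \<xi>)"

text \<open>\<open>\<Phi>\<^sub>i\<^sub>+\<^sub>1\<^sub>/\<^sub>2\<close> as a function of the states in cells \<open>i\<close> and \<open>i + 1\<close>.\<close>

definition Phi_flux ::
    "(real \<Rightarrow> real) \<Rightarrow> (real \<Rightarrow> real) \<Rightarrow> (real \<Rightarrow> real) \<Rightarrow> real \<Rightarrow> real \<Rightarrow> real" where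
  "Phi_flux q1 q2 \<psi> cl cr = Phi_pos q1 q2 \<psi> cl - Phi_neg q1 q2 \<psi> cr"

end

theory Submission
  imports Defs
begin

text \<open>
  The CFL condition makes the kinetic update \<open>\<phi>\<close> a pointwise convex combination of the indicators
  \<open>\<chi>\<^sub>i\<^sub>-\<^sub>1\<close>, \<open>\<chi>\<^sub>i\<close>, \<open>\<chi>\<^sub>i\<^sub>+\<^sub>1\<close>, so \<open>0 \<le> \<phi> \<le> 1\<close> and the discrete concentrations stay in [0,1]. Among all
  densities with values in [0,1] and prescribed mass \<open>C\<close>, the indicator \<open>\<chi>(C, \<cdot>)\<close> minimises
  \<open>\<integral> \<psi>' \<phi>\<close> because \<open>\<psi>'\<close> is nondecreasing; hence \<open>\<psi> C - \<psi> 0 \<le> \<integral> \<psi>' \<phi>\<close>, and the right-hand side is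
  computed by integrating the kinetic scheme against \<open>\<psi>'\<close>.
\<close>

section \<open>Integrals over intervals and the minimality of indicators\<close>

lemma average_mem_unit_interval:
  fixes g :: "real \<Rightarrow> real"
  assumes "a < b" and g: "\<And>x. x \<in> {a<..<b} \<Longrightarrow> g x \<in> {0..1}"
  shows "(LINT x:{a<..<b}|lebesgue. g x) / (b - a) \<in> {0..1}"
proof -
  have "0 \<le> (LINT x:{a<..<b}|lebesgue. g x)"
    unfolding set_lebesgue_integral_def
    by (rule Bochner_Integration.integral_nonneg) (use g in \<open>auto simp: indicator_def\<close>)
  moreover have "(LINT x:{a<..<b}|lebesgue. g x) \<le> (LINT x|lebesgue. indicator {a<..<b} x)"
    unfolding set_lebesgue_integral_def
  \<comment> \<open>If \<open>g\<close> is not integrable on the interval, its integral is 0 by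
    convention, so the bound by the nonnegative integrable majorant holds in that case too.\<close>
  proof (rule integral_mono')
    show "integrable lebesgue (indicator {a<..<b} :: real \<Rightarrow> real)"
      using assms(1) by (intro integrable_real_indicator) (auto simp: emeasure_lborel_Ioo)
  qed (use g in \<open>auto simp: indicator_def\<close>)
  moreover have "(LINT x|lebesgue. indicator {a<..<b} x) = b - a"
    using assms(1) by simp
  ultimately show ?thesis using assms(1) by (simp add: divide_simps)
qed

text \<open>Multiplying by the indicator cuts the domain down to \<open>{0<..<c}\<close>, and
  endpoints are null sets. This links the Lebesgue integrals over \<open>{0..c}\<close> in the
  entropy fluxes to integrals over the open interval on which the scheme is posed.\<close>

lemma has_integral_mult_kchi:
  assumes F: "continuous_on {0..1} F" and c: "c \<in> {0..1}"
  shows "((\<lambda>\<xi>. F \<xi> * kchi c \<xi>) has_integral (LINT \<xi>:{0..c}|lebesgue. F \<xi>)) {0<..<1}"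
proof -
  have cont: "continuous_on {0..c} F"
    using c by (intro continuous_on_subset[OF F]) auto
  have "set_integrable lebesgue {0..c} F"
    using absolutely_integrable_continuous_real[OF cont] .
  then have "(F has_integral (LINT \<xi>:{0..c}|lebesgue. F \<xi>)) {0..c}"
    using has_integral_set_lebesgue by blast
  then have "(F has_integral (LINT \<xi>:{0..c}|lebesgue. F \<xi>)) {0<..<c}"
    by (simp add: has_integral_Icc_iff_Ioo)
  then have "((\<lambda>\<xi>. if \<xi> \<in> {0<..<c} then F \<xi> else 0) has_integral
      (LINT \<xi>:{0..c}|lebesgue. F \<xi>)) {0<..<1}"
    using c by (subst has_integral_restrict) auto
  then show ?thesis
    by (rule has_integral_eq[rotated]) (auto simp: kchi_def)
qed

lemma LINT_deriv:
  assumes \<psi>: "\<And>x. \<psi> field_differentiable (at x)" and cont: "continuous_on {0..c} (deriv \<psi>)"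
    and "0 \<le> (c::real)"
  shows "(LINT \<xi>:{0..c}|lebesgue. deriv \<psi> \<xi>) = \<psi> c - \<psi> 0"
proof -
  have "set_integrable lebesgue {0..c} (deriv \<psi>)"
    using absolutely_integrable_continuous_real[OF cont] .
  moreover have "(deriv \<psi> has_integral \<psi> c - \<psi> 0) {0..c}"
  proof (rule fundamental_theorem_of_calculus)
    fix x assume "x \<in> {0..c}"
    show "(\<psi> has_vector_derivative deriv \<psi> x) (at x within {0..c})"
      using \<psi>[of x] by (metis DERIV_deriv_iff_field_differentiable has_field_derivative_at_within
          has_real_derivative_iff_has_vector_derivative)
  qed fact
  ultimately show ?thesis
    using has_integral_set_lebesgue has_integral_unique by blast
qed

lemma LINT_one: "0 \<le> c \<Longrightarrow> (LINT \<xi>:{0..c}|lebesgue. 1) = (c::real)"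
  by (simp add: set_lebesgue_integral_def)

text \<open>A bathtub principle: \<open>g\<close> and \<open>kchi C\<close> have the same mass, and
  moving mass to the left can only decrease the integral against a nondecreasing weight.\<close>

lemma convex_le_kinetic_entropy:
  assumes \<psi>: "\<And>x. \<psi> field_differentiable (at x)" and cont: "continuous_on UNIV (deriv \<psi>)"
    and mono: "mono (deriv \<psi>)"
    and g: "\<And>\<xi>. \<xi> \<in> {0<..<1} \<Longrightarrow> g \<xi> \<in> {0..1}"
    and C: "(g has_integral C) {0<..<1::real}" "C \<in> {0..1}"
    and K: "((\<lambda>\<xi>. deriv \<psi> \<xi> * g \<xi>) has_integral K) {0<..<1}"
  shows "\<psi> C - \<psi> 0 \<le> K"
proof -
  have "((\<lambda>\<xi>. deriv \<psi> \<xi> * kchi C \<xi>) has_integral (\<psi> C - \<psi> 0)) {0<..<1}"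
    using has_integral_mult_kchi[of "deriv \<psi>" C] LINT_deriv[OF \<psi>, of C] C(2)
    by (metis atLeastAtMost_iff cont continuous_on_subset top_greatest)
  moreover have "(kchi C has_integral C) {0<..<1}"
    using has_integral_mult_kchi[of "\<lambda>_. 1" C] LINT_one[of C] C(2) by simp
  \<comment> \<open>The term with the constant \<open>deriv \<psi> C\<close> integrates to 0 because
    the masses agree. Subtracting it makes the integrand a product whose two factors both change
    sign at \<open>\<xi> = C\<close>.\<close>
  ultimately have int: "((\<lambda>\<xi>. (deriv \<psi> \<xi> * g \<xi> - deriv \<psi> \<xi> * kchi C \<xi>) - deriv \<psi> C * (g \<xi> - kchi C \<xi>))
      has_integral ((K - (\<psi> C - \<psi> 0)) - deriv \<psi> C * (C - C))) {0<..<1}"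
    using C(1) K by (intro has_integral_diff has_integral_mult_right)
  have nonneg: "0 \<le> (deriv \<psi> \<xi> * g \<xi> - deriv \<psi> \<xi> * kchi C \<xi>) - deriv \<psi> C * (g \<xi> - kchi C \<xi>)"
    if \<xi>: "\<xi> \<in> {0<..<1}" for \<xi>
  proof -
    have "0 \<le> (deriv \<psi> \<xi> - deriv \<psi> C) * (g \<xi> - kchi C \<xi>)"
    proof (cases "\<xi> < C")
      case True
      then have "deriv \<psi> \<xi> \<le> deriv \<psi> C" "kchi C \<xi> = 1"
        using monoD[OF mono, of \<xi> C] \<xi> by (auto simp: kchi_def)
      then show ?thesis using g[OF \<xi>] by (intro mult_nonpos_nonpos) auto
    next
      case False
      then have "deriv \<psi> C \<le> deriv \<psi> \<xi>" "kchi C \<xi> = 0"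
        using monoD[OF mono, of C \<xi>] \<xi> by (auto simp: kchi_def)
      then show ?thesis using g[OF \<xi>] by (intro mult_nonneg_nonneg) auto
    qed
    then show ?thesis by (simp add: algebra_simps)
  qed
  show ?thesis
    using has_integral_nonneg[OF int nonneg] by simp
qed

section \<open>Regularity of the isotherm functions\<close>

lemma C1_01_has_vector_derivative:
  assumes "C1_01 g" "x \<in> {0..1}"
  shows "(g has_vector_derivative deriv01 g x) (at x within {0..1})"
  using assms by (simp add: C1_01_def deriv01_def vector_derivative_works)

lemma C1_01_continuous_on: "C1_01 g \<Longrightarrow> continuous_on {0..1} g"
  by (meson C1_01_def continuous_on_eq_continuous_within differentiable_imp_continuous_within)

lemma continuous_on_iso_h:
  assumes "C1_01 q1" "C1_01 q2"
  shows "continuous_on {0..1} (iso_h q1 q2)"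
  unfolding iso_h_def using assms by (intro continuous_intros C1_01_continuous_on)

lemma continuous_on_iso_a:
  assumes "C1_01 q1" "C1_01 q2"
  shows "continuous_on {0..1} (iso_a q1 q2)"
proof -
  \<comment> \<open>The product rule and the uniqueness of derivatives within [0,1] replace the
    derivative in \<open>iso_a\<close> by a formula whose continuity is evident.\<close>
  have "iso_a q1 q2 x
      = 1 + (deriv01 q1 x - (iso_h q1 q2 x + x * (deriv01 q1 x + deriv01 q2 x)))"
    if x: "x \<in> {0..1}" for x
  proof -
    have "(iso_f q1 q2 has_vector_derivative
        deriv01 q1 x - (x * (deriv01 q1 x + deriv01 q2 x) + 1 * (q1 x + q2 x))) (at x within {0..1})"
      unfolding iso_f_def iso_h_def
      by (intro has_vector_derivative_diff has_vector_derivative_mult has_vector_derivative_add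
          has_vector_derivative_id C1_01_has_vector_derivative assms x)
    then show ?thesis
      unfolding iso_a_def deriv01_def[of "iso_f q1 q2"]
      using x by (subst vector_derivative_within_closed_interval[of 0 1]) (auto simp: iso_h_def add.commute)
  qed
  moreover have "continuous_on {0..1}
      (\<lambda>x. 1 + (deriv01 q1 x - (iso_h q1 q2 x + x * (deriv01 q1 x + deriv01 q2 x))))"
    using assms by (intro continuous_intros continuous_on_iso_h) (auto simp: C1_01_def)
  ultimately show ?thesis
    by (simp cong: continuous_on_cong_simp)
qed

lemma abs_le_supnorm01:
  assumes "continuous_on {0..1} g" "x \<in> {0..1}"
  shows "\<bar>g x\<bar> \<le> supnorm01 g"
proof -
  have "bdd_above ((\<lambda>x. \<bar>g x\<bar>) ` {0..1})"
    using assms(1)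
    by (intro bounded_imp_bdd_above compact_imp_bounded compact_continuous_image continuous_intros) auto
  then show ?thesis
    unfolding supnorm01_def using assms(2) by (rule cSUP_upper[rotated])
qed

lemma space_node_nonneg: "(\<And>n. 0 < dx n) \<Longrightarrow> 0 \<le> space_node dx n"
  by (simp add: space_node_def sum_nonneg less_imp_le)

section \<open>The kinetic update as an explicit function of three neighbouring states\<close>

definition kupdate ::
    "(real \<Rightarrow> real) \<Rightarrow> (real \<Rightarrow> real) \<Rightarrow> real \<Rightarrow> real \<Rightarrow> real \<Rightarrow> real \<Rightarrow> real \<Rightarrow> real" where
  "kupdate q1 q2 \<mu> cl cm cr \<xi> =
     kchi cm \<xi> - \<mu> * (kflux q1 q2 cm cr \<xi> - kflux q1 q2 cl cm \<xi>
       + iso_h q1 q2 cm * (kchi cm \<xi> - kchi cl \<xi>))"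

lemma kupdate_mem_unit_interval:
  assumes "0 \<le> \<mu>" "0 \<le> iso_h q1 q2 cm" "\<mu> * (iso_h q1 q2 cm + \<bar>iso_a q1 q2 \<xi>\<bar>) \<le> 1"
  shows "kupdate q1 q2 \<mu> cl cm cr \<xi> \<in> {0..1}"
proof -
  \<comment> \<open>The weights of the left and right indicators; the middle one receives
    \<open>1 - p - m\<close>. Here \<open>iso_h \<ge> 0\<close> gives \<open>p \<ge> 0\<close>, and
    the third assumption is \<open>p + m \<le> 1\<close>.\<close>
  define p where "p = \<mu> * (iso_a_pos q1 q2 \<xi> + iso_h q1 q2 cm)"
  define m where "m = \<mu> * iso_a_neg q1 q2 \<xi>"
  have "kupdate q1 q2 \<mu> cl cm cr \<xi> = (1 - p - m) * kchi cm \<xi> + p * kchi cl \<xi> + m * kchi cr \<xi>"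
    by (simp add: kupdate_def kflux_def p_def m_def algebra_simps)
  moreover have "0 \<le> p" "0 \<le> m"
    using assms by (auto simp: p_def m_def iso_a_pos_def iso_a_neg_def intro!: mult_nonneg_nonpos)
  moreover have "p + m = \<mu> * (iso_h q1 q2 cm + \<bar>iso_a q1 q2 \<xi>\<bar>)"
    by (auto simp: p_def m_def iso_a_pos_def iso_a_neg_def algebra_simps max_def min_def)
  ultimately show ?thesis
    using assms(3) by (auto simp: kchi_def)
qed

text \<open>The update is linear in the three indicators, so each term integrates to a primitive at
  \<open>cl\<close>, \<open>cm\<close> or \<open>cr\<close>. The weight 1 serves for the
  integrability of the update; the weight \<open>deriv \<psi>\<close> turns \<open>P\<close> and
  \<open>N\<close> into the entropy fluxes.\<close>

lemma has_integral_mult_kupdate: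
  fixes q1 q2 w :: "real \<Rightarrow> real"
  defines "W \<equiv> \<lambda>c. LINT \<xi>:{0..c}|lebesgue. w \<xi>"
    and "P \<equiv> \<lambda>c. LINT \<xi>:{0..c}|lebesgue. w \<xi> * iso_a_pos q1 q2 \<xi>"
    and "N \<equiv> \<lambda>c. LINT \<xi>:{0..c}|lebesgue. w \<xi> * iso_a_neg q1 q2 \<xi>"
  assumes C1: "C1_01 q1" "C1_01 q2" and w: "continuous_on {0..1} w"
    and c: "cl \<in> {0..1}" "cm \<in> {0..1}" "cr \<in> {0..1}"
  shows "((\<lambda>\<xi>. w \<xi> * kupdate q1 q2 \<mu> cl cm cr \<xi>) has_integral
      W cm - \<mu> * ((P cm - N cr) - (P cl - N cm) + iso_h q1 q2 cm * (W cm - W cl))) {0<..<1}"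
proof -
  note a = continuous_on_iso_a[OF C1]
  have "continuous_on {0..1} (\<lambda>\<xi>. w \<xi> * iso_a_pos q1 q2 \<xi>)"
    "continuous_on {0..1} (\<lambda>\<xi>. w \<xi> * iso_a_neg q1 q2 \<xi>)"
    unfolding iso_a_pos_def iso_a_neg_def using a w by (auto intro!: continuous_intros)
  note I = has_integral_mult_kchi[OF w] this[THEN has_integral_mult_kchi]
  have "((\<lambda>\<xi>. w \<xi> * kchi cm \<xi> - \<mu> * ((w \<xi> * iso_a_pos q1 q2 \<xi> * kchi cm \<xi>
          - w \<xi> * iso_a_neg q1 q2 \<xi> * kchi cr \<xi>) - (w \<xi> * iso_a_pos q1 q2 \<xi> * kchi cl \<xi>
          - w \<xi> * iso_a_neg q1 q2 \<xi> * kchi cm \<xi>)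
          + iso_h q1 q2 cm * (w \<xi> * kchi cm \<xi> - w \<xi> * kchi cl \<xi>))) has_integral
      W cm - \<mu> * ((P cm - N cr) - (P cl - N cm) + iso_h q1 q2 cm * (W cm - W cl))) {0<..<1}"
    unfolding W_def P_def N_def
    by (intro has_integral_diff has_integral_add has_integral_mult_right I c)
  then show ?thesis
    by (rule has_integral_eq[rotated]) (simp add: kupdate_def kflux_def algebra_simps)
qed

section \<open>The discrete entropy inequality\<close>

theorem proposition5p3:
  fixes q1 q2 cb c0 ub \<psi> :: "real \<Rightarrow> real"
    and dt :: real and dx :: "nat \<Rightarrow> real"
    and u c :: "nat \<Rightarrow> nat \<Rightarrow> real" and \<phi> :: "nat \<Rightarrow> nat \<Rightarrow> real \<Rightarrow> real"
  assumes "isotherms q1 q2"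
    and "admissible_data cb c0 ub"
    and "dt > 0" and "\<And>n. dx n > 0"
    and "kinetic_scheme q1 q2 cb c0 ub dt dx u c \<phi>"
    and "\<And>n i. i \<ge> 1 \<Longrightarrow> u n i > 0"
    and CFL: "\<And>n. (supnorm01 (iso_h q1 q2) + 2 * supnorm01 (iso_a q1 q2)) * dx n
                     \<le> (INF i\<in>{1..}. u n i) * dt"
    and "smooth_real \<psi>" and "\<And>x. (deriv ^^ 2) \<psi> x \<ge> 0"
  shows "\<forall>n. \<forall>i\<ge>1.
    u n i * \<psi> (c (Suc n) i)
      \<le> u n i * \<psi> (c n i)
        - dx n / dt * (Phi_flux q1 q2 \<psi> (c n i) (c n (i + 1)) - Phi_flux q1 q2 \<psi> (c n (i - 1)) (c n i))
        - dx n / dt * iso_h q1 q2 (c n i) * (\<psi> (c n i) - \<psi> (c n (i - 1)))"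
proof -
  have C1: "C1_01 q1" "C1_01 q2" and h_nonneg: "\<And>x. x \<in> {0..1} \<Longrightarrow> 0 \<le> iso_h q1 q2 x"
    using assms(1) by (auto simp: isotherms_def)
  note cont_h = continuous_on_iso_h[OF C1] and cont_a = continuous_on_iso_a[OF C1]
  note scheme = assms(5)[unfolded kinetic_scheme_def]
  \<comment> \<open>The factor left after dividing the kinetic relation by
    \<open>dt * u n i\<close>. Unlike \<open>\<phi>\<close>, which the scheme fixes only for \<xi>
    in (0,1), \<open>K\<close> is given by a formula everywhere.\<close>
  define \<mu> where "\<mu> n i = dx n / (dt * u n i)" for n i
  define K where "K n i = kupdate q1 q2 (\<mu> n i) (c n (i - 1)) (c n i) (c n (i + 1))" for n i

  have \<phi>_eq: "\<phi> (Suc n) i \<xi> = K n i \<xi>" if "i \<ge> 1" "\<xi> \<in> {0<..<1}" for n i \<xi>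
  proof -
    have "dt * u n i \<noteq> 0" using assms(3) assms(6)[OF that(1), of n] by simp
    moreover have "dt * u n i * (\<phi> (Suc n) i \<xi> - kchi (c n i) \<xi>)
        + dx n * (kflux q1 q2 (c n i) (c n (i + 1)) \<xi> - kflux q1 q2 (c n (i - 1)) (c n i) \<xi>)
        + dx n * iso_h q1 q2 (c n i) * (kchi (c n i) \<xi> - kchi (c n (i - 1)) \<xi>) = 0"
      using scheme that by blast
    ultimately show ?thesis
      by (simp add: K_def kupdate_def \<mu>_def field_simps)
  qed

  have K_mem: "K n i \<xi> \<in> {0..1}" if i: "i \<ge> 1" and "\<xi> \<in> {0..1}" "c n i \<in> {0..1}" for n i \<xi>
    unfolding K_def
  proof (rule kupdate_mem_unit_interval)
    have u: "0 < dt * u n i" using assms(3) assms(6)[OF i, of n] by simp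
    then show "0 \<le> \<mu> n i" using assms(4)[of n] by (simp add: \<mu>_def)
    show "0 \<le> iso_h q1 q2 (c n i)" using h_nonneg that by blast
    have "iso_h q1 q2 (c n i) + \<bar>iso_a q1 q2 \<xi>\<bar>
        \<le> supnorm01 (iso_h q1 q2) + 2 * supnorm01 (iso_a q1 q2)"
      using abs_le_supnorm01[OF cont_h that(3)] abs_le_supnorm01[OF cont_a that(2)] by linarith
    then have "dx n * (iso_h q1 q2 (c n i) + \<bar>iso_a q1 q2 \<xi>\<bar>)
        \<le> (supnorm01 (iso_h q1 q2) + 2 * supnorm01 (iso_a q1 q2)) * dx n"
      using assms(4)[of n] by (simp add: mult.commute)
    also have "\<dots> \<le> (INF i\<in>{1..}. u n i) * dt" by (rule CFL)
    also have "\<dots> \<le> u n i * dt"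
    proof (rule mult_right_mono)
      \<comment> \<open>Positivity of \<open>u\<close> bounds the set below, so the real-valued
        \<open>INF\<close> is a genuine lower bound.\<close>
      have "bdd_below (u n ` {1..})"
        using assms(6)[THEN less_imp_le] by (auto intro!: bdd_belowI2[where m = 0])
      then show "(INF i\<in>{1..}. u n i) \<le> u n i"
        using i by (intro cINF_lower) auto
    qed (use assms(3) in simp)
    finally show "\<mu> n i * (iso_h q1 q2 (c n i) + \<bar>iso_a q1 q2 \<xi>\<bar>) \<le> 1"
      using u by (simp add: \<mu>_def field_simps)
  qed

  have K_int: "(K n i has_integral c (Suc n) i) {0<..<1}"
    if i: "i \<ge> 1" and c: "\<And>j. c n j \<in> {0..1}" for n i
  proof -
    have int: "K n i integrable_on {0<..<1}"
      using has_integral_mult_kupdate[OF C1 continuous_on_const[of _ 1] c c c]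
      unfolding K_def by fastforce
    \<comment> \<open>Nonnegativity upgrades gauge integrability to Lebesgue integrability. Hence
      the integral defining \<open>c (Suc n) i\<close> is the true mass of \<open>K n i\<close> and
      not a default 0.\<close>
    then have "K n i absolutely_integrable_on {0<..<1}"
      using K_mem[OF i _ c] by (intro nonnegative_absolutely_integrable_1) auto
    moreover have "c (Suc n) i = (LINT \<xi>:{0<..<1}|lebesgue. K n i \<xi>)"
      using scheme i \<phi>_eq[OF i] by (auto intro!: set_lebesgue_integral_cong)
    ultimately show ?thesis
      using has_integral_set_lebesgue by metis
  qed

  have boundary: "c n 0 \<in> {0..1}" for n
  proof -
    have "(LINT x:{space_node dx n <..< space_node dx (Suc n)}|lebesgue. c0 x)
        / (space_node dx (Suc n) - space_node dx n) \<in> {0..1}"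
    proof (rule average_mem_unit_interval)
      fix x assume "x \<in> {space_node dx n <..< space_node dx (Suc n)}"
      then have "x > 0" using space_node_nonneg[of dx n] assms(4) by auto
      then show "c0 x \<in> {0..1}" using assms(2) by (simp add: admissible_data_def)
    qed (use assms(4) in \<open>simp add: space_node_def\<close>)
    then show ?thesis using scheme by (simp add: space_node_def)
  qed

  \<comment> \<open>The update at level \<open>n\<close> involves three columns, so the induction on
    \<open>n\<close> covers all \<open>i\<close> at once. Column 0 is not updated by the scheme and
    is supplied by the averages of \<open>c0\<close>.\<close>
  have c_mem: "c n i \<in> {0..1}" for n i
  proof (induction n arbitrary: i)
    case 0
    have "(LINT t:time_cell dt i|lebesgue. cb t) / (real i * dt - (real i - 1) * dt) \<in> {0..1}"
      if "i \<ge> 1"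
      unfolding time_cell_def
    proof (rule average_mem_unit_interval)
      fix t assume t: "t \<in> {(real i - 1) * dt <..< real i * dt}"
      have "0 \<le> (real i - 1) * dt" using that assms(3) by simp
      then have "t > 0" using t by simp
      then show "cb t \<in> {0..1}" using assms(2) by (simp add: admissible_data_def)
    qed (use assms(3) in \<open>simp add: algebra_simps\<close>)
    then have "c 0 i \<in> {0..1}" if "i \<ge> 1"
      using that scheme by (simp add: algebra_simps)
    moreover have "c 0 0 \<in> {0..1}" using boundary by blast
    ultimately show ?case by (cases "i = 0") auto
  next
    case (Suc n)
    show ?case
    proof (cases "i = 0")
      case True
      then show ?thesis using boundary by blast
    next
      case False
      then have i: "i \<ge> 1" by simp
      have "0 \<le> c (Suc n) i"
        by (rule has_integral_nonneg[OF K_int[OF i Suc.IH]]) (use K_mem[OF i _ Suc.IH] in auto)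
      moreover have "c (Suc n) i \<le> 1"
      proof (rule has_integral_le[OF K_int[OF i Suc.IH]])
        show "((\<lambda>_. 1 :: real) has_integral 1) {0<..<1::real}"
          using has_integral_const_real[of "1::real" 0 1] by (simp add: has_integral_Icc_iff_Ioo)
      qed (use K_mem[OF i _ Suc.IH] in auto)
      ultimately show ?thesis by simp
    qed
  qed

  have \<psi>: "\<psi> field_differentiable (at x)" "deriv \<psi> field_differentiable (at x)" for x
    using assms(8)[unfolded smooth_real_def, rule_format, of 0 x]
      assms(8)[unfolded smooth_real_def, rule_format, of 1 x] by auto
  have cont: "continuous_on UNIV (deriv \<psi>)"
    using \<psi>(2) by (simp add: continuous_at_imp_continuous_on field_differentiable_imp_continuous_at)
  have "mono (deriv \<psi>)"
  proof (rule monoI)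
    fix x y :: real assume "x \<le> y"
    then show "deriv \<psi> x \<le> deriv \<psi> y"
    proof (rule DERIV_nonneg_imp_nondecreasing)
      fix z
      show "\<exists>d. (deriv \<psi> has_real_derivative d) (at z) \<and> 0 \<le> d"
        using \<psi>(2)[of z] assms(9)[of z]
        by (auto simp: numeral_2_eq_2 simp flip: DERIV_deriv_iff_field_differentiable)
    qed
  qed

  show ?thesis
  proof (intro allI impI)
    fix n i :: nat assume i: "i \<ge> 1"
    let ?L = "c n (i - 1)" and ?M = "c n i" and ?R = "c n (i + 1)"
    \<comment> \<open>Flux difference and \<open>h\<close> term together: what
      \<open>\<mu> n i\<close> multiplies once the update is integrated against
      \<open>deriv \<psi>\<close>.\<close>
    define B where "B = Phi_flux q1 q2 \<psi> ?M ?R - Phi_flux q1 q2 \<psi> ?L ?M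
      + iso_h q1 q2 ?M * (\<psi> ?M - \<psi> ?L)"
    have W: "(LINT \<xi>:{0..c n j}|lebesgue. deriv \<psi> \<xi>) = \<psi> (c n j) - \<psi> 0" for j
      using c_mem[of n j] by (intro LINT_deriv \<psi> continuous_on_subset[OF cont]) auto
    have "((\<lambda>\<xi>. deriv \<psi> \<xi> * K n i \<xi>) has_integral \<psi> ?M - \<psi> 0 - \<mu> n i * B) {0<..<1}"
      using has_integral_mult_kupdate[OF C1 continuous_on_subset[OF cont subset_UNIV]
          c_mem[of n "i - 1"] c_mem[of n i] c_mem[of n "i + 1"], of "\<mu> n i"]
      by (simp add: K_def B_def W Phi_flux_def Phi_pos_def Phi_neg_def)
    \<comment> \<open>The density \<open>K n i\<close> has values in [0,1] and mass
      \<open>c (Suc n) i\<close>, so minimality of the indicator applies. Afterwards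
      \<open>\<psi> 0\<close> cancels and \<open>u n i * \<mu> n i = dx n / dt\<close>.\<close>
    then have "\<psi> (c (Suc n) i) - \<psi> 0 \<le> \<psi> ?M - \<psi> 0 - \<mu> n i * B"
      using K_mem[OF i _ c_mem]
      by (intro convex_le_kinetic_entropy[OF \<psi>(1) cont \<open>mono (deriv \<psi>)\<close> _ K_int[OF i c_mem] c_mem]) auto
    then have "u n i * \<psi> (c (Suc n) i) \<le> u n i * (\<psi> ?M - \<mu> n i * B)"
      using assms(6)[OF i, of n] by simp
    also have "\<dots> = u n i * \<psi> ?M - dx n / dt * B"
      using assms(6)[OF i, of n] by (simp add: \<mu>_def right_diff_distrib)
    finally show "u n i * \<psi> (c (Suc n) i)
      \<le> u n i * \<psi> (c n i)
        - dx n / dt * (Phi_flux q1 q2 \<psi> (c n i) (c n (i + 1)) - Phi_flux q1 q2 \<psi> (c n (i - 1)) (c n i))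
        - dx n / dt * iso_h q1 q2 (c n i) * (\<psi> (c n i) - \<psi> (c n (i - 1)))"
      by (simp add: B_def algebra_simps)
  qed
qed

end
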